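(* Let $p\ge 3$, let $Z=(Z_1,\dots,Z_p) \sim N(0,\Sigma)$ be a centered Gaussian vector in $\mathbb{R}^p$ with arbitrary covariance $\Sigma$, let $M = \max_{1 \le i \le p} Z_i$, and let $\mu= \mathbb{E}[M]$. If $\mu > 0$, then $$\sqrt{\operatorname{Var}(M)} \;\ge\; \frac{\mu}{15 \log p}.$$
   Context: $\log$ is the natural logarithm. *)

theory Defs
  imports "HOL-Probability.Probability"
begin

text \<open>
  The normal law with mean 0 and variance \<open>v \<ge> 0\<close>.  The library's \<^const>\<open>normal_density\<close> is
  parametrised by the standard deviation and only describes the nondegenerate case; the normal law
  of variance 0 is the Dirac measure at 0.
\<close>
definition centered_normal :: "real \<Rightarrow> real measure" where
  "centered_normal v =
     (if v = 0 then return borel 0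
      else density lborel (\<lambda>x. ennreal (normal_density 0 (sqrt v) x)))"

definition covariance_matrix :: "real ^ 'n ^ 'n \<Rightarrow> bool" where
  "covariance_matrix C \<longleftrightarrow> transpose C = C \<and> (\<forall>t. 0 \<le> t \<bullet> (C *v t))"

text \<open>
  \<open>Z \<sim> N(0, C)\<close>: every linear functional \<open>t \<bullet> Z\<close> is normal with mean 0 and variance \<open>t\<^sup>T C t\<close>.
  Singular matrices \<open>C\<close> are allowed.
\<close>
definition centered_gaussian_vector ::
    "'a measure \<Rightarrow> ('a \<Rightarrow> real ^ 'n) \<Rightarrow> real ^ 'n ^ 'n \<Rightarrow> bool" where
  "centered_gaussian_vector P Z C \<longleftrightarrow>
     prob_space P \<and> covariance_matrix C \<and> Z \<in> borel_measurable P \<and>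
     (\<forall>t. distr P borel (\<lambda>\<omega>. t \<bullet> Z \<omega>) = centered_normal (t \<bullet> (C *v t)))"

definition max_coord :: "real ^ 'n \<Rightarrow> real" where
  "max_coord x = (MAX i. x $ i)"

end

theory Submission
  imports Defs
begin

text \<open>
  The logarithm of \<open>M\<close> has density at most \<open>L = 2 log p + 1 + sqrt (log p / \<pi>)\<close> on \<open>M > 0\<close>.
  Write \<open>Z = Z\<^sub>i b + W\<close> with \<open>W\<close> independent of \<open>Z\<^sub>i\<close>. Conditioning on \<open>W\<close>, the density of \<open>M\<close> at
  \<open>z > 0\<close> is \<open>\<Sum>\<^sub>i n\<^sub>i(z) q\<^sub>i(z)\<close>, where \<open>n\<^sub>i\<close> is the density of \<open>Z\<^sub>i\<close> and \<open>q\<^sub>i(z)\<close> is the probability that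
  \<open>z b + W\<close> lies in the polytope \<open>max \<le> z\<close>. The wedges \<open>{Z\<^sub>i > z, z b + W \<in> polytope}\<close> erected over the
  facets consist of points whose nearest point of the polytope lies on that facet (in the geometry of
  the covariance), so once repeated coordinates are dropped they are almost surely disjoint and \<open>\<Sum>\<^sub>i P(Z\<^sub>i > z) q\<^sub>i(z) \<le> 1\<close>. Mills' ratio gives
  \<open>z n\<^sub>i(z) \<le> (z\<^sup>2 / \<sigma>\<^sub>i\<^sup>2 + 1) P(Z\<^sub>i > z)\<close>; it is used when \<open>z\<^sup>2 \<le> 2 \<sigma>\<^sub>i\<^sup>2 log p\<close>, and for the other
  coordinates \<open>z n\<^sub>i(z) \<le> sqrt (log p / \<pi>) / p\<close>. Hence \<open>M\<close> falls into \<open>\<mu> (1 - x, 1 + x]\<close> with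
  probability at most about \<open>2 L x\<close>, so its standard deviation cannot be much smaller than that of a
  uniform law on an interval of length \<open>\<mu> / L\<close>.
\<close>

subsection \<open>Characteristic functions on Euclidean spaces\<close>

text \<open>The weights need not have total mass 1: dividing by the common mass \<open>c\<close>
  reduces to Levy's theorem for probability laws. Cosines with arbitrary phase keep the tests real
  and still contain the sine, hence the whole characteristic function.\<close>

lemma Levy_uniqueness_weighted:
  fixes X :: "'a \<Rightarrow> real" and Y :: "'b \<Rightarrow> real" and u :: "'a \<Rightarrow> real" and v :: "'b \<Rightarrow> real"
  assumes [measurable]: "X \<in> borel_measurable M" "Y \<in> borel_measurable N"
    and u: "integrable M u" and v: "integrable N v"
    and u0: "\<And>x. 0 \<le> u x" and v0: "\<And>x. 0 \<le> v x"
    and eq: "\<And>s \<psi>. (\<integral>x. u x * cos (s * X x + \<psi>) \<partial>M) = (\<integral>y. v y * cos (s * Y y + \<psi>) \<partial>N)"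
    and S: "S \<in> sets borel"
  shows "(\<integral>x. u x * indicat_real S (X x) \<partial>M) = (\<integral>y. v y * indicat_real S (Y y) \<partial>N)"
proof -
  define c where "c = (\<integral>x. u x \<partial>M)"
  have [measurable]: "u \<in> borel_measurable M" "v \<in> borel_measurable N"
    using u v by auto
  have c': "c = (\<integral>y. v y \<partial>N)" using eq[of 0 0] by (simp add: c_def)
  have cos_int: "integrable M (\<lambda>x. u x * cos (s * X x + \<psi>))" for s \<psi>
    by (rule Bochner_Integration.integrable_bound[OF u])
       (auto simp: abs_mult intro!: mult_left_le)
  have cos_int': "integrable N (\<lambda>x. v x * cos (s * Y x + \<psi>))" for s \<psi>
    by (rule Bochner_Integration.integrable_bound[OF v])
       (auto simp: abs_mult intro!: mult_left_le)
  have "c \<ge> 0" unfolding c_def using u0 by simp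
  show ?thesis
  proof (cases "c = 0")
    case True
    have "AE x in M. u x = 0"
      using integral_nonneg_eq_0_iff_AE[OF u] u0 True by (auto simp: c_def)
    moreover have "AE x in N. v x = 0"
      using integral_nonneg_eq_0_iff_AE[OF v] v0 True by (auto simp: c')
    ultimately have "(\<integral>x. u x * indicat_real S (X x) \<partial>M) = 0"
      "(\<integral>x. v x * indicat_real S (Y x) \<partial>N) = 0"
      by (auto intro!: integral_eq_zero_AE elim!: eventually_mono)
    then show ?thesis by simp
  next
    case False
    then have c0: "c > 0" using \<open>c \<ge> 0\<close> by simp
    define M' where "M' = distr (density M (\<lambda>x. ennreal (u x / c))) borel X"
    define N' where "N' = distr (density N (\<lambda>x. ennreal (v x / c))) borel Y"
    have prob: "prob_space (density L (\<lambda>x. ennreal (w x / c)))"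
      if [measurable]: "integrable L w" and "\<And>x. 0 \<le> w x" "c = (\<integral>x. w x \<partial>L)"
      for L :: "'z measure" and w
    proof (rule prob_spaceI)
      have "emeasure (density L (\<lambda>x. ennreal (w x / c))) (space (density L (\<lambda>x. ennreal (w x / c))))
          = (\<integral>\<^sup>+x. ennreal (w x / c) \<partial>L)"
        using that(1) by (auto simp: emeasure_density cong: nn_integral_cong)
      also have "\<dots> = ennreal (\<integral>x. w x / c \<partial>L)"
        using that c0 by (intro nn_integral_eq_integral) auto
      also have "\<dots> = 1" using that(3) c0 by simp
      finally show "emeasure (density L (\<lambda>x. ennreal (w x / c))) (space (density L (\<lambda>x. ennreal (w x / c)))) = 1" .
    qed
    interpret M1: prob_space "density M (\<lambda>x. ennreal (u x / c))"
      using prob[OF u u0] by (simp add: c_def)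
    interpret N1: prob_space "density N (\<lambda>x. ennreal (v x / c))"
      using prob[OF v v0] by (simp add: c')
    have "real_distribution M'" "real_distribution N'"
      unfolding M'_def N'_def by (auto intro!: M1.real_distribution_distr N1.real_distribution_distr)
    moreover have "char M' = char N'"
    proof
      fix s
      \<comment> \<open>The phase \<open>-pi/2\<close> turns the cosine into the sine.\<close>
      have iexp_cos: "a * iexp (s * b) = complex_of_real (a * cos (s * b + 0)) + \<i> * complex_of_real (a * cos (s * b + (-pi/2)))"
        for a b :: real
      proof -
        have "iexp (s * b) = cis (s * b)" by (simp add: cis_conv_exp)
        then show ?thesis
          by (simp add: complex_eq_iff cos_diff)
      qed
      have lint: "(CLINT x|L. complex_of_real (f x) + \<i> * complex_of_real (g x))
          = complex_of_real (\<integral>x. f x \<partial>L) + \<i> * complex_of_real (\<integral>x. g x \<partial>L)"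
        if "integrable L f" "integrable L g" for L :: "'z measure" and f g
      proof -
        have "(CLINT x|L. complex_of_real (f x) + \<i> * complex_of_real (g x))
            = (CLINT x|L. complex_of_real (f x)) + (CLINT x|L. \<i> * complex_of_real (g x))"
          using that by (intro Bochner_Integration.integral_add) auto
        then show ?thesis by simp
      qed
      have "char M' s = (CLINT x|M. (u x / c) *\<^sub>R iexp (s * X x))"
        unfolding char_def M'_def using c0 u0
        by (subst integral_distr, simp, simp) (subst integral_density, auto)
      also have "\<dots> = (CLINT x|M. u x * iexp (s * X x)) / c"
        by (simp add: scaleR_conv_of_real flip: integral_divide_zero)
      also have "(CLINT x|M. u x * iexp (s * X x)) = complex_of_real (\<integral>x. u x * cos (s * X x + 0) \<partial>M)
           + \<i> * complex_of_real (\<integral>x. u x * cos (s * X x + (-pi/2)) \<partial>M)"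
        unfolding iexp_cos by (rule lint[OF cos_int cos_int])
      also have "\<dots> = complex_of_real (\<integral>x. v x * cos (s * Y x + 0) \<partial>N)
           + \<i> * complex_of_real (\<integral>x. v x * cos (s * Y x + (-pi/2)) \<partial>N)"
        unfolding eq ..
      also have "\<dots> = (CLINT x|N. v x * iexp (s * Y x))"
        unfolding iexp_cos by (rule lint[OF cos_int' cos_int', symmetric])
      also have "\<dots> / c = (CLINT x|N. (v x / c) *\<^sub>R iexp (s * Y x))"
        by (simp add: scaleR_conv_of_real flip: integral_divide_zero)
      also have "\<dots> = char N' s"
        unfolding char_def N'_def using c0 v0
        by (subst integral_distr, simp, simp) (subst integral_density, auto)
      finally show "char M' s = char N' s" .
    qed
    ultimately have "M' = N'" by (rule Levy_uniqueness)
    then have "(\<integral>x. indicat_real S x \<partial>M') = (\<integral>x. indicat_real S x \<partial>N')" by simp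
    moreover have "(\<integral>x. indicat_real S x \<partial>M') = (\<integral>x. u x * indicat_real S (X x) \<partial>M) / c"
      unfolding M'_def using S c0 u0
      by (subst integral_distr, simp, simp, subst integral_density) (auto simp flip: integral_divide_zero)
    moreover have "(\<integral>x. indicat_real S x \<partial>N') = (\<integral>x. v x * indicat_real S (Y x) \<partial>N) / c"
      unfolding N'_def using S c0 v0
      by (subst integral_distr, simp, simp, subst integral_density) (auto simp flip: integral_divide_zero)
    ultimately show ?thesis using c0 by simp
  qed
qed

text \<open>Levy's theorem is applied one basis direction at a time: each application adds an
  indicator constraint on one more coordinate while the cosine factor stays arbitrary. With all
  coordinates constrained and frequency 0, this gives the measures of boxes.\<close>

lemma euclidean_char_uniqueness:
  fixes M N :: "'a::euclidean_space measure"
  assumes M: "prob_space M" and N: "prob_space N"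
    and sM[measurable_cong]: "sets M = sets borel" and sN[measurable_cong]: "sets N = sets borel"
    and eq: "\<And>t. (CLINT x|M. iexp (t \<bullet> x)) = (CLINT x|N. iexp (t \<bullet> x))"
  shows "M = N"
proof -
  interpret M: prob_space M by fact
  interpret N: prob_space N by fact
  have intM[simp]: "integrable M (\<lambda>x. indicat_real {x. \<forall>b\<in>A. x \<bullet> b \<in> S b} x * cos (t \<bullet> x + \<theta>))"
    if "finite A" "\<And>b. S b \<in> sets borel" for A S t \<theta>
    using that by (intro M.integrable_const_bound[where B=1]) (auto split: split_indicator)
  have intN[simp]: "integrable N (\<lambda>x. indicat_real {x. \<forall>b\<in>A. x \<bullet> b \<in> S b} x * cos (t \<bullet> x + \<theta>))"
    if "finite A" "\<And>b. S b \<in> sets borel" for A S t \<theta>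
    using that by (intro N.integrable_const_bound[where B=1]) (auto split: split_indicator)
  \<comment> \<open>Frequency and phase stay general because the induction step uses the hypothesis
    at the shifted frequencies \<open>t + s *\<^sub>R b\<close> and
    \<open>t - s *\<^sub>R b\<close>.\<close>
  have key: "\<forall>S t \<theta>. (\<forall>b. S b \<in> sets borel) \<longrightarrow>
      (\<integral>x. indicator {x. \<forall>b\<in>A. x \<bullet> b \<in> S b} x * cos (t \<bullet> x + \<theta>) \<partial>M)
    = (\<integral>x. indicator {x. \<forall>b\<in>A. x \<bullet> b \<in> S b} x * cos (t \<bullet> x + \<theta>) \<partial>N)" (is "?P A")
    if "finite A" for A
    using that
  proof (induction A)
    case empty
    have cos_eq: "cos (y + \<theta>) = Re (cis \<theta> * iexp y)" for y \<theta> :: real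
      by (simp add: cis_conv_exp[symmetric] cis_mult add.commute)
    have "(\<integral>x. cos (t \<bullet> x + \<theta>) \<partial>L) = Re (cis \<theta> * (CLINT x|L. iexp (t \<bullet> x)))"
      if "prob_space L" and [measurable_cong]: "sets L = sets borel" for L t \<theta>
    proof -
      interpret L: prob_space L by fact
      have i: "integrable L (\<lambda>x. iexp (t \<bullet> x))"
        by (rule L.integrable_const_bound[where B=1])
           (auto simp: measurable_cong_sets[OF that(2) refl]
             intro!: borel_measurable_continuous_onI continuous_intros)
      have "(\<integral>x. Re (cis \<theta> * iexp (t \<bullet> x)) \<partial>L) = Re (CLINT x|L. cis \<theta> * iexp (t \<bullet> x))"
        using i by (intro integral_Re) auto
      also have "(CLINT x|L. cis \<theta> * iexp (t \<bullet> x)) = cis \<theta> * (CLINT x|L. iexp (t \<bullet> x))"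
        by (rule integral_mult_right_zero)
      finally show ?thesis unfolding cos_eq .
    qed
    from this[OF M sM] this[OF N sN] show ?case by (simp add: eq)
  next
    case (insert b A)
    show ?case
    proof (intro allI impI)
      fix S :: "'a \<Rightarrow> real set" and t :: 'a and \<theta> :: real
      assume S: "\<forall>b. S b \<in> sets borel"
      define D where "D = indicat_real {x. \<forall>b\<in>A. x \<bullet> b \<in> S b}"
      note IH = insert.IH[rule_format, of S, folded D_def]
      have iM: "integrable M (\<lambda>x. D x * cos (t \<bullet> x + \<theta>))" for t \<theta>
        unfolding D_def using S insert.hyps by (intro intM) auto
      have iN: "integrable N (\<lambda>x. D x * cos (t \<bullet> x + \<theta>))" for t \<theta>
        unfolding D_def using S insert.hyps by (intro intN) auto
      have [measurable]: "D \<in> borel_measurable borel"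
        unfolding D_def using S insert.hyps by measurable
      \<comment> \<open>A cosine changes sign and cannot serve as a weight, but
        \<open>1 + cos\<close> can. The product-to-sum formula writes weight times test function as
        three cosines, each covered by the induction hypothesis.\<close>
      have exp: "D x * (1 + cos (t \<bullet> x + \<theta>)) * cos (s * (x \<bullet> b) + \<psi>)
         = D x * cos ((s *\<^sub>R b) \<bullet> x + \<psi>) + (D x * cos ((t + s *\<^sub>R b) \<bullet> x + (\<theta> + \<psi>))) / 2
           + (D x * cos ((t - s *\<^sub>R b) \<bullet> x + (\<theta> - \<psi>))) / 2" for x s \<theta> \<psi>
      proof -
        have "(t + s *\<^sub>R b) \<bullet> x + (\<theta> + \<psi>) = (t \<bullet> x + \<theta>) + (s * (x \<bullet> b) + \<psi>)"
          "(t - s *\<^sub>R b) \<bullet> x + (\<theta> - \<psi>) = (t \<bullet> x + \<theta>) - (s * (x \<bullet> b) + \<psi>)"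
          "(s *\<^sub>R b) \<bullet> x + \<psi> = s * (x \<bullet> b) + \<psi>"
          by (simp_all add: inner_add_left inner_diff_left inner_commute[of b])
        moreover have "d * (1 + cos p) * cos q = d * cos q + (d * cos (p + q)) / 2 + (d * cos (p - q)) / 2"
          for d p q :: real
          by (simp add: cos_add cos_diff field_simps)
        ultimately show ?thesis by metis
      qed
      have iu: "integrable M (\<lambda>x. D x * (1 + cos (t \<bullet> x + \<theta>)))" for \<theta>
        using iM[of t \<theta>] iM[of 0 0] by (simp add: distrib_left)
      have iv: "integrable N (\<lambda>x. D x * (1 + cos (t \<bullet> x + \<theta>)))" for \<theta>
        using iN[of t \<theta>] iN[of 0 0] by (simp add: distrib_left)
      have pos: "0 \<le> D x * (1 + cos (t \<bullet> x + \<theta>))" for x \<theta>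
        unfolding D_def using cos_ge_minus_one[of "t \<bullet> x + \<theta>"]
        by (intro mult_nonneg_nonneg) (auto simp del: cos_ge_minus_one)
      have *: "(\<integral>x. D x * (1 + cos (t \<bullet> x + \<theta>)) * indicat_real (S b) (x \<bullet> b) \<partial>M)
         = (\<integral>x. D x * (1 + cos (t \<bullet> x + \<theta>)) * indicat_real (S b) (x \<bullet> b) \<partial>N)" for \<theta>
      proof (rule Levy_uniqueness_weighted)
        show "(\<integral>x. D x * (1 + cos (t \<bullet> x + \<theta>)) * cos (s * (x \<bullet> b) + \<psi>) \<partial>M)
            = (\<integral>x. D x * (1 + cos (t \<bullet> x + \<theta>)) * cos (s * (x \<bullet> b) + \<psi>) \<partial>N)" for s \<psi>
          unfolding exp using iM iN S by (simp add: IH del: inner_scaleR_left)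
      qed (use S iu iv pos in auto)
      \<comment> \<open>Shifting the phase by \<open>pi\<close> flips the sign of the cosine, so
        subtracting the two weights removes the constant 1 and leaves the bare cosine.\<close>
      have ind: "indicat_real {x. \<forall>b\<in>insert b A. x \<bullet> b \<in> S b} x * cos (t \<bullet> x + \<theta>)
         = (D x * (1 + cos (t \<bullet> x + \<theta>)) * indicat_real (S b) (x \<bullet> b)) / 2
          - (D x * (1 + cos (t \<bullet> x + (\<theta> + pi))) * indicat_real (S b) (x \<bullet> b)) / 2" for x
      proof -
        have "cos (t \<bullet> x + (\<theta> + pi)) = - cos (t \<bullet> x + \<theta>)"
          by (simp flip: add.assoc)
        then show ?thesis by (auto simp: D_def field_simps split: split_indicator)
      qed
      have jM: "integrable M (\<lambda>x. D x * (1 + cos (t \<bullet> x + \<theta>)) * indicat_real (S b) (x \<bullet> b))" for \<theta>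
        using S by (intro Bochner_Integration.integrable_bound[OF iu[of \<theta>]]) (auto split: split_indicator)
      have jN: "integrable N (\<lambda>x. D x * (1 + cos (t \<bullet> x + \<theta>)) * indicat_real (S b) (x \<bullet> b))" for \<theta>
        using S by (intro Bochner_Integration.integrable_bound[OF iv[of \<theta>]]) (auto split: split_indicator)
      show "(\<integral>x. indicator {x. \<forall>b\<in>insert b A. x \<bullet> b \<in> S b} x * cos (t \<bullet> x + \<theta>) \<partial>M)
          = (\<integral>x. indicator {x. \<forall>b\<in>insert b A. x \<bullet> b \<in> S b} x * cos (t \<bullet> x + \<theta>) \<partial>N)"
        unfolding ind using jM jN by (simp add: *)
    qed
  qed
  have box: "emeasure M (box l u) = emeasure N (box l u)" for l u :: 'a
  proof -
    have b: "box l u = {x. \<forall>b\<in>Basis. x \<bullet> b \<in> {l \<bullet> b <..< u \<bullet> b}}"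
      by (auto simp: box_def)
    have "(\<integral>x. indicat_real (box l u) x \<partial>M) = (\<integral>x. indicat_real (box l u) x \<partial>N)"
      using key[OF finite_Basis, rule_format, of "\<lambda>b. {l \<bullet> b <..< u \<bullet> b}" 0 0]
      by (simp add: b)
    then show ?thesis
      by (simp add: M.emeasure_eq_measure N.emeasure_eq_measure sM sN)
  qed
  show ?thesis
  proof (rule measure_eqI_generator_eq)
    show "Int_stable (range (\<lambda>(a, b). box a b :: 'a set))"
      by (auto simp: Int_stable_def box_Int_box)
    show "range (\<lambda>(a, b). box a b :: 'a set) \<subseteq> Pow UNIV" by simp
    show "sets M = sigma_sets UNIV (range (\<lambda>(a, b). box a b))"
      unfolding sM borel_eq_box by simp
    show "sets N = sigma_sets UNIV (range (\<lambda>(a, b). box a b))"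
      unfolding sN borel_eq_box by simp
    show "range (\<lambda>n. box (- (real n *\<^sub>R One)) (real n *\<^sub>R One) :: 'a set) \<subseteq> range (\<lambda>(a, b). box a b)"
      by auto
    show "(\<Union>n. box (- (real n *\<^sub>R One)) (real n *\<^sub>R One) :: 'a set) = UNIV"
      by (rule UN_box_eq_UNIV)
  qed (auto simp: box)
qed

subsection \<open>Normal densities\<close>

lemma char_centered_normal:
  assumes "v \<ge> 0"
  shows "char (centered_normal v) u = complex_of_real (exp (- (v * u\<^sup>2) / 2))"
proof (cases "v = 0")
  case True
  then show ?thesis by (simp add: centered_normal_def char_def integral_return)
next
  case False
  with assms have v: "v > 0" by simp
  interpret prob_space std_normal_distribution
    by (rule prob_space_normal_density) simp
  have "distributed std_normal_distribution lborel (\<lambda>x. x) std_normal_density"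
    by (auto simp: distributed_def distr_id2)
  then have "distributed std_normal_distribution lborel (\<lambda>x. 0 + sqrt v * x)
     (normal_density (0 + sqrt v * 0) (\<bar>sqrt v\<bar> * 1))"
    using v by (intro normal_density_affine) auto
  then have "distr std_normal_distribution lborel (\<lambda>x. sqrt v * x) = centered_normal v"
    using v by (simp add: distributed_def centered_normal_def)
  moreover have "distr std_normal_distribution lborel (\<lambda>x. sqrt v * x)
     = distr std_normal_distribution borel (\<lambda>x. sqrt v * x)"
    by (rule distr_cong) auto
  ultimately have "centered_normal v = distr std_normal_distribution borel (\<lambda>x. sqrt v * x)"
    by simp
  then have "char (centered_normal v) u = char std_normal_distribution (u * sqrt v)"
    by (simp add: char_def integral_distr mult.assoc)
  also have "\<dots> = complex_of_real (exp (- (v * u\<^sup>2) / 2))"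
    using v by (simp add: char_std_normal_distribution power_mult_distrib mult.commute)
  finally show ?thesis .
qed

text \<open>Mills' ratio: \<open>- n(x) / x\<close> vanishes at infinity and has derivative
  \<open>n(x) (1/\<sigma>^2 + 1/x^2)\<close>. Beyond \<open>z\<close> the bracket is at most its
  value at \<open>z\<close>, so integrating from \<open>z\<close> bounds \<open>n(z) / z\<close> by
  that value times the tail.\<close>

lemma normal_density_tail_bound:
  fixes \<sigma> z :: real
  assumes \<sigma>: "\<sigma> > 0" and z: "z > 0"
  shows "z * normal_density 0 \<sigma> z
    \<le> (z\<^sup>2 / \<sigma>\<^sup>2 + 1) * measure (density lborel (\<lambda>x. ennreal (normal_density 0 \<sigma> x))) {z<..}"
proof -
  let ?n = "normal_density 0 \<sigma>"
  define D where "D = density lborel (\<lambda>x. ennreal (?n x))"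
  interpret D: prob_space D
    unfolding D_def by (rule prob_space_normal_density) (fact \<sigma>)
  have deriv: "((\<lambda>x. - (?n x / x)) has_real_derivative ?n x * (1 / \<sigma>\<^sup>2 + 1 / x\<^sup>2)) (at x)" if "z \<le> x" for x
  proof -
    define k where "k = 1 / sqrt (2 * pi * \<sigma>\<^sup>2)"
    have n: "?n = (\<lambda>x. k * exp (- x\<^sup>2 / (2 * \<sigma>\<^sup>2)))"
      by (simp add: fun_eq_iff normal_density_def k_def)
    have "(?n has_real_derivative - (x / \<sigma>\<^sup>2) * ?n x) (at x)"
      unfolding n using \<sigma>
      by (auto intro!: derivative_eq_intros simp: field_simps eval_nat_numeral)
    then have "((\<lambda>x. - (?n x / x)) has_real_derivative - ((- (x / \<sigma>\<^sup>2) * ?n x * x - ?n x * 1) / (x * x))) (at x)"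
      using z that by (intro DERIV_minus DERIV_divide DERIV_ident) auto
    moreover have "- ((- (x / \<sigma>\<^sup>2) * ?n x * x - ?n x * 1) / (x * x)) = ?n x * (1 / \<sigma>\<^sup>2 + 1 / x\<^sup>2)"
      using z \<sigma> that by (simp add: field_simps power2_eq_square)
    ultimately show ?thesis by simp
  qed
  have lim: "((\<lambda>x. - (?n x / x)) \<longlongrightarrow> 0) at_top"
  proof (rule Lim_null_comparison)
    show "\<forall>\<^sub>F x in at_top. norm (- (?n x / x)) \<le> (1 / sqrt (2 * pi * \<sigma>\<^sup>2)) * inverse x"
      using eventually_gt_at_top[of "0::real"]
    proof eventually_elim
      case (elim x)
      then show ?case
        using \<sigma> by (simp add: normal_density_def field_simps)
    qed
    show "((\<lambda>x. (1 / sqrt (2 * pi * \<sigma>\<^sup>2)) * inverse x) \<longlongrightarrow> 0) at_top"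
      by (intro tendsto_mult_right_zero tendsto_inverse_0_at_top filterlim_ident)
  qed
  have "ennreal (?n z / z) = (\<integral>\<^sup>+x. ennreal (?n x * (1 / \<sigma>\<^sup>2 + 1 / x\<^sup>2)) * indicator {z..} x \<partial>lborel)"
    using nn_integral_FTC_atLeast[OF _ deriv _ lim] by simp
  also have "\<dots> \<le> (\<integral>\<^sup>+x. ennreal (1 / \<sigma>\<^sup>2 + 1 / z\<^sup>2) * (ennreal (?n x) * indicator {z<..} x) \<partial>lborel)"
  \<comment> \<open>The endpoint is a null set, which permits passing from \<open>{z..}\<close> to
    \<open>{z<..}\<close>.\<close>
  proof (rule nn_integral_mono_AE, use AE_lborel_singleton[of z] in eventually_elim)
    case (elim x)
    have "?n x * (1 / \<sigma>\<^sup>2 + 1 / x\<^sup>2) \<le> (1 / \<sigma>\<^sup>2 + 1 / z\<^sup>2) * ?n x" if "z < x"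
    proof -
      have "1 / x\<^sup>2 \<le> 1 / z\<^sup>2" using that z by (intro divide_left_mono power_mono) auto
      then show ?thesis by (subst mult.commute) (intro mult_right_mono, auto)
    qed
    then show ?case using elim
      by (auto simp: ennreal_mult'[symmetric] simp del: ennreal_plus
          split: split_indicator intro!: ennreal_leI)
  qed
  also have "\<dots> = ennreal (1 / \<sigma>\<^sup>2 + 1 / z\<^sup>2) * emeasure D {z<..}"
    by (subst nn_integral_cmult) (auto simp: D_def emeasure_density)
  also have "\<dots> = ennreal ((1 / \<sigma>\<^sup>2 + 1 / z\<^sup>2) * measure D {z<..})"
    by (simp add: D.emeasure_eq_measure ennreal_mult'')
  finally have "?n z / z \<le> (1 / \<sigma>\<^sup>2 + 1 / z\<^sup>2) * measure D {z<..}"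
    by (subst (asm) ennreal_le_iff) auto
  then have "z\<^sup>2 * (?n z / z) \<le> z\<^sup>2 * ((1 / \<sigma>\<^sup>2 + 1 / z\<^sup>2) * measure D {z<..})"
    by (intro mult_left_mono) auto
  moreover have "z\<^sup>2 * (?n z / z) = z * ?n z"
    using z by (simp add: power2_eq_square)
  moreover have "z\<^sup>2 * ((1 / \<sigma>\<^sup>2 + 1 / z\<^sup>2) * measure D {z<..}) = (z\<^sup>2 / \<sigma>\<^sup>2 + 1) * measure D {z<..}"
    using z by (simp add: field_simps)
  ultimately show ?thesis unfolding D_def by simp
qed

text \<open>With \<open>r = z / \<sigma>\<close> the left side is
  \<open>r exp(-r^2/2) / sqrt (2 * pi)\<close>, which decreases for
  \<open>r \<ge> 1\<close>.\<close>

lemma normal_density_far_bound: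
  fixes \<sigma> z R :: real
  assumes \<sigma>: "\<sigma> > 0" and R: "1 \<le> R" "R \<le> z / \<sigma>"
  shows "z * normal_density 0 \<sigma> z \<le> R * exp (- R\<^sup>2 / 2) / sqrt (2 * pi)"
proof -
  define r where "r = z / \<sigma>"
  have r: "R \<le> r" "z = r * \<sigma>" using R \<sigma> by (auto simp: r_def)
  \<comment> \<open>Monotonicity without derivatives: \<open>1 + x \<le> exp x\<close> at
    \<open>x = r / R - 1\<close>, then \<open>(r - R) / R\<close> is compared with
    \<open>(r^2 - R^2) / 2\<close> using \<open>R \<ge> 1\<close>.\<close>
  have "r / R \<le> exp (r / R - 1)" using exp_ge_add_one_self[of "r / R - 1"] by simp
  also have "\<dots> \<le> exp (r\<^sup>2 / 2 - R\<^sup>2 / 2)"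
  proof -
    have "r / R - 1 = (r - R) / R" using R by (simp add: field_simps)
    also have "\<dots> \<le> (r - R) / 1" using R r by (intro divide_left_mono) auto
    also have "\<dots> = (r - R) * 1" by simp
    also have "\<dots> \<le> (r - R) * ((r + R) / 2)" using R r by (intro mult_left_mono) auto
    also have "\<dots> = r\<^sup>2 / 2 - R\<^sup>2 / 2" by (simp add: power2_eq_square field_simps)
    finally show ?thesis by simp
  qed
  also have "\<dots> = exp (- R\<^sup>2 / 2) / exp (- r\<^sup>2 / 2)"
    by (simp flip: exp_diff)
  finally have "r * exp (- r\<^sup>2 / 2) \<le> R * exp (- R\<^sup>2 / 2)"
    using R by (simp add: field_simps)
  moreover have "z * normal_density 0 \<sigma> z = r * exp (- r\<^sup>2 / 2) / sqrt (2 * pi)"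
    using \<sigma> by (simp add: normal_density_def r real_sqrt_mult power_mult_distrib)
  ultimately show ?thesis by (simp add: divide_right_mono)
qed

subsection \<open>Gaussian vectors\<close>

locale gaussian_vector =
  fixes P :: "'a measure" and Z :: "'a \<Rightarrow> real ^ 'n" and C :: "real ^ 'n ^ 'n"
  assumes gaussian: "centered_gaussian_vector P Z C"
begin

sublocale prob_space P
  using gaussian by (simp add: centered_gaussian_vector_def)

lemma Z_measurable [measurable]: "Z \<in> borel_measurable P"
  using gaussian by (simp add: centered_gaussian_vector_def)

lemma coord_measurable [measurable]: "(\<lambda>\<omega>. Z \<omega> $ i) \<in> borel_measurable P"
proof -
  have "(\<lambda>\<omega>. axis i 1 \<bullet> Z \<omega>) \<in> borel_measurable P" by measurable
  then show ?thesis by (simp add: inner_axis')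
qed

lemma distr_inner: "distr P borel (\<lambda>\<omega>. t \<bullet> Z \<omega>) = centered_normal (t \<bullet> (C *v t))"
  using gaussian by (simp add: centered_gaussian_vector_def)

lemma cov_nonneg: "0 \<le> t \<bullet> (C *v t)"
  using gaussian by (simp add: centered_gaussian_vector_def covariance_matrix_def)

section \<open>The covariance as a bilinear form\<close>

lemma cov_commute: "a \<bullet> (C *v b) = b \<bullet> (C *v a)"
proof -
  have "transpose C = C"
    using gaussian by (simp add: centered_gaussian_vector_def covariance_matrix_def)
  then have "a \<bullet> (C *v b) = (C *v a) \<bullet> b"
    using dot_lmul_matrix[of a C b] by (metis vector_transpose_matrix)
  then show ?thesis by (simp add: inner_commute)
qed

lemma cov_axis: "axis i 1 \<bullet> (C *v axis j 1) = C $ i $ j"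
  by (simp add: inner_axis' matrix_vector_mult_basis column_def)

lemma cov_sym: "C $ i $ j = C $ j $ i"
  by (metis cov_axis cov_commute)

lemma cov_diag_nonneg: "0 \<le> C $ i $ i"
  using cov_nonneg[of "axis i 1"] by (simp add: cov_axis)

lemma cov_add: "(a + c *\<^sub>R b) \<bullet> (C *v (a + c *\<^sub>R b))
    = a \<bullet> (C *v a) + 2 * c * (a \<bullet> (C *v b)) + c\<^sup>2 * (b \<bullet> (C *v b))"
  using cov_commute[of b a]
  by (simp add: matrix_vector_right_distrib matrix_vector_mult_scaleR inner_add_left inner_add_right
      power2_eq_square algebra_simps)

text \<open>The form is only positive semidefinite. The variance of \<open>a + c b\<close> is a
  nonnegative polynomial in \<open>c\<close>, of degree at most one when \<open>b\<close> has
  variance zero; hence the two cases.\<close>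

lemma cov_Cauchy_Schwarz: "(a \<bullet> (C *v b))\<^sup>2 \<le> (a \<bullet> (C *v a)) * (b \<bullet> (C *v b))"
proof -
  define qa qb m where "qa = a \<bullet> (C *v a)" and "qb = b \<bullet> (C *v b)" and "m = a \<bullet> (C *v b)"
  have *: "0 \<le> qa + 2 * c * m + c\<^sup>2 * qb" for c
    using cov_nonneg[of "a + c *\<^sub>R b"] unfolding cov_add qa_def qb_def m_def .
  have "qb \<ge> 0" unfolding qb_def by (rule cov_nonneg)
  have "m\<^sup>2 \<le> qa * qb"
  proof (cases "qb = 0")
    case True
    \<comment> \<open>If \<open>m\<close> were nonzero, the chosen \<open>c\<close> would give the
      affine polynomial the value -1.\<close>
    then have "m = 0"
      using *[of "- (qa + 1) / (2 * m)"] by (cases "m = 0") (auto simp: field_simps)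
    with True show ?thesis by simp
  next
    case False
    with \<open>qb \<ge> 0\<close> have "qb > 0" by simp
    \<comment> \<open>The chosen \<open>c = - m / qb\<close> minimises the quadratic.\<close>
    then have "0 \<le> qa - m\<^sup>2 / qb"
      using *[of "- m / qb"] by (simp add: field_simps power2_eq_square)
    with \<open>qb > 0\<close> show ?thesis by (simp add: field_simps)
  qed
  then show ?thesis unfolding qa_def qb_def m_def .
qed

lemma iexp_inner:
  "(CLINT \<omega>|P. iexp (t \<bullet> Z \<omega>)) = complex_of_real (exp (- (t \<bullet> (C *v t)) / 2))"
proof -
  have "(CLINT \<omega>|P. iexp (t \<bullet> Z \<omega>)) = char (distr P borel (\<lambda>\<omega>. t \<bullet> Z \<omega>)) 1"
    by (simp add: char_def integral_distr)
  then show ?thesis by (simp add: distr_inner char_centered_normal cov_nonneg)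
qed

section \<open>Regression on one coordinate\<close>

definition slope :: "'n \<Rightarrow> real ^ 'n" where
  "slope i = C $ i /\<^sub>R (C $ i $ i)"

text \<open>\<open>slope i\<close> collects the regression coefficients of all coordinates on the
  \<open>i\<close>-th one, and this is the regression residual: the \<open>b\<close> and
  \<open>W\<close> of the overview.\<close>

definition resid :: "'n \<Rightarrow> 'a \<Rightarrow> real ^ 'n" where
  "resid i \<omega> = Z \<omega> - (Z \<omega> $ i) *\<^sub>R slope i"

lemma resid_measurable [measurable]: "resid i \<in> borel_measurable P"
  unfolding resid_def
  by (intro borel_measurable_diff borel_measurable_scaleR Z_measurable coord_measurable borel_measurable_const)

text \<open>The residual is uncorrelated with \<open>Z\<^sub>i\<close>, so the joint Gaussian
  characteristic function factorises; uniqueness on the product space turns this into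
  independence.\<close>

lemma distr_coord_resid:
  assumes i: "C $ i $ i > 0"
  shows "distr P borel (\<lambda>\<omega>. Z \<omega> $ i) \<Otimes>\<^sub>M distr P borel (resid i)
    = distr P (borel \<Otimes>\<^sub>M borel) (\<lambda>\<omega>. (Z \<omega> $ i, resid i \<omega>))"
proof -
  let ?X = "\<lambda>\<omega>. Z \<omega> $ i"
  interpret X: prob_space "distr P borel ?X" by (rule prob_space_distr) simp
  interpret W: prob_space "distr P borel (resid i)" by (rule prob_space_distr) simp
  interpret XW: pair_prob_space "distr P borel ?X" "distr P borel (resid i)" ..
  let ?\<mu> = "distr P borel ?X \<Otimes>\<^sub>M distr P borel (resid i)"
  let ?\<nu> = "distr P (borel \<Otimes>\<^sub>M borel) (\<lambda>\<omega>. (?X \<omega>, resid i \<omega>))"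
  show "?\<mu> = ?\<nu>"
  proof (rule euclidean_char_uniqueness)
    show "prob_space ?\<mu>" by (rule XW.prob_space_axioms)
    show "prob_space ?\<nu>" by (rule prob_space_distr) measurable
    show s1: "sets ?\<mu> = sets borel" by (simp add: borel_prod[symmetric] cong: sets_pair_measure_cong)
    show "sets ?\<nu> = sets borel" by (simp add: borel_prod)
    fix st :: "real \<times> (real ^ 'n)"
    obtain s t where st: "st = (s, t)" by (cases st)
    \<comment> \<open>The regression is moved onto the test vector:
      \<open>t \<bullet> resid i \<omega> = t' \<bullet> Z \<omega>\<close>, and \<open>t'\<close>
      is orthogonal to \<open>axis i 1\<close> in the covariance form, which kills the cross term of
      \<open>cov_add\<close>.\<close>
    define t' where "t' = t - (t \<bullet> slope i) *\<^sub>R axis i 1"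
    have tW: "t \<bullet> resid i \<omega> = t' \<bullet> Z \<omega>" for \<omega>
      by (simp add: resid_def t'_def inner_diff_left inner_diff_right inner_axis inner_axis')
    have sX: "s * ?X \<omega> = (s *\<^sub>R axis i 1) \<bullet> Z \<omega>" for \<omega>
      by (simp add: inner_axis')
    have sum: "st \<bullet> (?X \<omega>, resid i \<omega>) = (t' + s *\<^sub>R axis i 1) \<bullet> Z \<omega>" for \<omega>
      unfolding st inner_Pair tW inner_real_def sX by (simp add: inner_add_left)
    have Ci: "C *v axis i 1 = C $ i"
      by (simp add: vec_eq_iff matrix_vector_mult_basis column_def cov_sym[of i])
    have ortho: "t' \<bullet> (C *v axis i 1) = 0"
      using i by (simp add: t'_def inner_diff_left slope_def Ci inner_axis')
    have cont: "(\<lambda>x. iexp (st \<bullet> x)) \<in> borel_measurable borel"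
      by (intro borel_measurable_continuous_onI continuous_intros)
    have "(CLINT x|?\<nu>. iexp (st \<bullet> x)) = (CLINT \<omega>|P. iexp (st \<bullet> (?X \<omega>, resid i \<omega>)))"
      using cont by (subst integral_distr) (auto simp: borel_prod)
    also have "\<dots> = exp (- (t' \<bullet> (C *v t')) / 2) * exp (- (s\<^sup>2 * C $ i $ i) / 2)"
      unfolding sum iexp_inner cov_add ortho cov_axis
      by (simp add: exp_add[symmetric] field_simps flip: of_real_mult)
    also have "\<dots> = (CLINT x|distr P borel (resid i). iexp (t \<bullet> x)) * (CLINT x|distr P borel ?X. iexp (s * x))"
    proof -
      have "(CLINT x|distr P borel (resid i). iexp (t \<bullet> x)) = (CLINT \<omega>|P. iexp (t' \<bullet> Z \<omega>))"
        by (subst integral_distr) (auto simp: tW intro!: borel_measurable_continuous_onI continuous_intros)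
      moreover have "(CLINT x|distr P borel ?X. iexp (s * x)) = (CLINT \<omega>|P. iexp ((s *\<^sub>R axis i 1) \<bullet> Z \<omega>))"
        by (subst integral_distr) (auto simp: inner_axis' intro!: borel_measurable_continuous_onI continuous_intros)
      moreover have "(s *\<^sub>R axis i 1) \<bullet> (C *v (s *\<^sub>R axis i 1)) = s\<^sup>2 * C $ i $ i"
        using cov_add[of 0 s "axis i 1"] by (simp add: cov_axis)
      ultimately show ?thesis by (simp only: iexp_inner of_real_mult)
    qed
    also have "\<dots> = (CLINT x|distr P borel ?X. CLINT y|distr P borel (resid i). iexp (st \<bullet> (x, y)))"
      by (simp add: st inner_Pair distrib_left exp_add mult.commute)
    also have "\<dots> = (CLINT x|?\<mu>. iexp (st \<bullet> x))"
    proof (rule XW.integral_fst')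
      show "integrable ?\<mu> (\<lambda>x. iexp (st \<bullet> x))"
        by (rule XW.integrable_const_bound[where B=1])
           (auto simp: measurable_cong_sets[OF s1 refl] intro!: cont)
    qed
    finally show "(CLINT x|?\<mu>. iexp (st \<bullet> x)) = (CLINT x|?\<nu>. iexp (st \<bullet> x))" ..
  qed
qed

section \<open>Null events, degenerate functionals and repeated coordinates\<close>

lemma AE_inner_neq:
  assumes "s \<noteq> 0"
  shows "AE \<omega> in P. t \<bullet> Z \<omega> \<noteq> s"
proof -
  \<comment> \<open>A degenerate functional is almost surely 0 and any other has a density, so only
    the value 0 can carry mass.\<close>
  have "AE x in distr P borel (\<lambda>\<omega>. t \<bullet> Z \<omega>). x \<noteq> s"
    unfolding distr_inner centered_normal_def
    using assms AE_lborel_singleton[of s] by (auto simp: AE_return AE_density)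
  then show ?thesis by (subst (asm) AE_distr_iff) auto
qed

lemma AE_inner_eq_0:
  assumes "t \<bullet> (C *v t) = 0"
  shows "AE \<omega> in P. t \<bullet> Z \<omega> = 0"
proof -
  have "AE x in distr P borel (\<lambda>\<omega>. t \<bullet> Z \<omega>). x = 0"
    unfolding distr_inner centered_normal_def using assms by (simp add: AE_return)
  then show ?thesis by (subst (asm) AE_distr_iff) auto
qed

lemma cov_diff_axis:
  "(axis i 1 + (-1) *\<^sub>R axis j 1) \<bullet> (C *v (axis i 1 + (-1) *\<^sub>R axis j 1)) = C $ i $ i - 2 * C $ i $ j + C $ j $ j"
  unfolding cov_add cov_axis by simp

text \<open>The two equalities give \<open>Z\<^sub>i - Z\<^sub>j\<close> variance zero; by
  Cauchy-Schwarz it is then uncorrelated with every \<open>Z\<^sub>k\<close>.\<close>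

lemma cov_row_eqI:
  assumes "C $ i $ i = C $ i $ j" "C $ j $ j = C $ i $ j"
  shows "C $ i = C $ j"
proof -
  have "C $ k $ i = C $ k $ j" for k
  proof -
    have "(axis k 1 \<bullet> (C *v (axis i 1 + (-1) *\<^sub>R axis j 1)))\<^sup>2 \<le> 0"
      using cov_Cauchy_Schwarz[of "axis k 1" "axis i 1 + (-1) *\<^sub>R axis j 1"]
      unfolding cov_diff_axis using assms by simp
    then have "axis k 1 \<bullet> (C *v (axis i 1 + (-1) *\<^sub>R axis j 1)) = 0" by simp
    then show ?thesis
      unfolding matrix_vector_right_distrib matrix_vector_mult_scaleR inner_add_right
        inner_scaleR_right cov_axis by simp
  qed
  then show ?thesis by (simp add: vec_eq_iff cov_sym[of i] cov_sym[of j])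
qed

text \<open>Equal rows force the difference to have variance zero, so rows of \<open>C\<close> can
  serve as labels for repeated coordinates.\<close>

lemma AE_coord_eq:
  assumes "C $ i = C $ j"
  shows "AE \<omega> in P. Z \<omega> $ i = Z \<omega> $ j"
proof -
  have "AE \<omega> in P. (axis i 1 + (-1) *\<^sub>R axis j 1) \<bullet> Z \<omega> = 0"
    by (rule AE_inner_eq_0, unfold cov_diff_axis) (use assms cov_sym[of i j] in simp)
  then show ?thesis by eventually_elim (simp add: inner_diff_left inner_axis')
qed

lemma distr_coord:
  assumes "C $ i $ i > 0"
  shows "distr P borel (\<lambda>\<omega>. Z \<omega> $ i) = density lborel (\<lambda>x. ennreal (normal_density 0 (sqrt (C $ i $ i)) x))"
  using distr_inner[of "axis i 1"] assms
  unfolding cov_axis by (simp add: inner_axis' centered_normal_def)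

text \<open>Fubini for the independent pair: fixing the value \<open>x\<close> of
  \<open>Z\<^sub>i\<close> leaves the law of the residual unchanged.\<close>

lemma emeasure_coord_resid:
  assumes i: "C $ i $ i > 0" and A: "A \<in> sets (borel \<Otimes>\<^sub>M borel)"
  shows "emeasure P {\<omega> \<in> space P. (Z \<omega> $ i, resid i \<omega>) \<in> A}
    = (\<integral>\<^sup>+x. ennreal (normal_density 0 (sqrt (C $ i $ i)) x)
         * emeasure P {\<omega> \<in> space P. (x, resid i \<omega>) \<in> A} \<partial>lborel)"
proof -
  interpret W: prob_space "distr P borel (resid i)" by (rule prob_space_distr) simp
  have A': "A \<in> sets (distr P borel (\<lambda>\<omega>. Z \<omega> $ i) \<Otimes>\<^sub>M distr P borel (resid i))"
    using A by (simp cong: sets_pair_measure_cong)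
  have A'': "A \<in> sets (borel \<Otimes>\<^sub>M distr P borel (resid i))"
    using A by (simp cong: sets_pair_measure_cong)
  have "emeasure P {\<omega> \<in> space P. (Z \<omega> $ i, resid i \<omega>) \<in> A}
      = emeasure (distr P (borel \<Otimes>\<^sub>M borel) (\<lambda>\<omega>. (Z \<omega> $ i, resid i \<omega>))) A"
    using A by (subst emeasure_distr) (auto intro!: arg_cong2[where f=emeasure])
  also have "\<dots> = (\<integral>\<^sup>+x. emeasure (distr P borel (resid i)) (Pair x -` A) \<partial>distr P borel (\<lambda>\<omega>. Z \<omega> $ i))"
    unfolding distr_coord_resid[OF i, symmetric] using A' by (rule W.emeasure_pair_measure_alt)
  also have "\<dots> = (\<integral>\<^sup>+x. ennreal (normal_density 0 (sqrt (C $ i $ i)) x)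
         * emeasure (distr P borel (resid i)) (Pair x -` A) \<partial>lborel)"
    unfolding distr_coord[OF i]
    using W.measurable_emeasure_Pair[OF A''] by (subst nn_integral_density) auto
  also have "(\<lambda>x. emeasure (distr P borel (resid i)) (Pair x -` A))
      = (\<lambda>x. emeasure P {\<omega> \<in> space P. (x, resid i \<omega>) \<in> A})"
    using sets_Pair1[OF A]
    by (intro ext, subst emeasure_distr) (auto intro!: arg_cong2[where f=emeasure])
  finally show ?thesis .
qed

section \<open>Facets, wedges and their disjointness\<close>

text \<open>
  Shifting \<open>Z\<close> along the regression direction \<open>slope i\<close> until its \<open>i\<close>-th coordinate equals \<open>z\<close>
  lands in the facet \<open>Z\<^sub>i = z\<close> of the polytope \<open>max Z \<le> z\<close>.
\<close>
definition facet :: "'n \<Rightarrow> real \<Rightarrow> 'a set" where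
  "facet i z = {\<omega> \<in> space P. \<forall>j. resid i \<omega> $ j \<le> z * (1 - slope i $ j)}"

text \<open>In terms of excesses over \<open>z\<close>: \<open>Z\<^sub>i - z\<close> is positive and
  each \<open>Z\<^sub>j - z\<close> is at most \<open>slope i $ j\<close> times it. The disjointness
  argument uses this form.\<close>

definition wedge :: "'n \<Rightarrow> real \<Rightarrow> 'a set" where
  "wedge i z = {\<omega> \<in> space P. z < Z \<omega> $ i} \<inter> facet i z"

lemma resid_coord: "resid i \<omega> $ j = Z \<omega> $ j - Z \<omega> $ i * slope i $ j"
  by (simp add: resid_def)

lemma slope_coord: "slope i $ j = C $ i $ j / C $ i $ i"
  by (simp add: slope_def divide_inverse mult.commute)

lemma facet_pair_sets: "{x \<in> space (borel \<Otimes>\<^sub>M P). snd x \<in> facet i (fst x)} \<in> sets (borel \<Otimes>\<^sub>M P)"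
  unfolding facet_def by (simp add: resid_coord space_pair_measure) measurable

lemma facet_sets [measurable]: "facet i z \<in> events"
  unfolding facet_def resid_coord by measurable

lemma wedge_sets [measurable]: "wedge i z \<in> events"
  unfolding wedge_def by measurable

lemma emeasure_facet_measurable [measurable]: "(\<lambda>z. emeasure P (facet i z)) \<in> borel_measurable borel"
proof -
  have "Pair z -` {x \<in> space (borel \<Otimes>\<^sub>M P). snd x \<in> facet i (fst x)} = facet i z" for z
    by (auto simp: space_pair_measure facet_def)
  with measurable_emeasure_Pair[OF facet_pair_sets[of i]] show ?thesis by simp
qed

lemma halfspace_pair_sets [measurable]:
  "{xw :: real \<times> (real ^ 'n). \<forall>j. snd xw $ j \<le> fst xw * (1 - c $ j)} \<in> sets (borel \<Otimes>\<^sub>M borel)"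
proof -
  have "closed {xw :: real \<times> (real ^ 'n). \<forall>j. snd xw $ j \<le> fst xw * (1 - c $ j)}"
    by (intro closed_Collect_all closed_Collect_le continuous_intros)
  then show ?thesis unfolding borel_prod by (rule borel_closed)
qed

text \<open>The facet event depends on the residual alone, hence is independent of
  \<open>Z\<^sub>i > z\<close>.\<close>

lemma prob_wedge:
  assumes i: "C $ i $ i > 0"
  shows "prob (wedge i z)
    = measure (density lborel (\<lambda>x. ennreal (normal_density 0 (sqrt (C $ i $ i)) x))) {z<..} * prob (facet i z)"
proof -
  let ?D = "density lborel (\<lambda>x. ennreal (normal_density 0 (sqrt (C $ i $ i)) x))"
  interpret D: prob_space ?D using i by (intro prob_space_normal_density) auto
  let ?A = "{z<..} \<times> {w. \<forall>j. w $ j \<le> z * (1 - slope i $ j)}"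
  have "closed {w :: real ^ 'n. \<forall>j. w $ j \<le> z * (1 - slope i $ j)}"
    by (intro closed_Collect_all closed_Collect_le continuous_intros)
  then have A: "?A \<in> sets (borel \<Otimes>\<^sub>M borel)" by auto
  have "emeasure P (wedge i z) = emeasure P {\<omega> \<in> space P. (Z \<omega> $ i, resid i \<omega>) \<in> ?A}"
    by (auto simp: wedge_def facet_def intro!: arg_cong2[where f=emeasure])
  also have "\<dots> = (\<integral>\<^sup>+x. ennreal (normal_density 0 (sqrt (C $ i $ i)) x)
         * emeasure P {\<omega> \<in> space P. (x, resid i \<omega>) \<in> ?A} \<partial>lborel)"
    by (rule emeasure_coord_resid[OF i A])
  also have "\<dots> = (\<integral>\<^sup>+x. (ennreal (normal_density 0 (sqrt (C $ i $ i)) x) * indicator {z<..} x)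
       * emeasure P (facet i z) \<partial>lborel)"
    by (intro nn_integral_cong) (auto simp: facet_def split: split_indicator)
  also have "\<dots> = emeasure ?D {z<..} * emeasure P (facet i z)"
    by (subst nn_integral_multc) (auto simp: emeasure_density)
  finally show ?thesis
    by (simp add: measure_def enn2real_mult)
qed

text \<open>In both wedges the excesses \<open>u\<close>, \<open>v\<close> over \<open>z\<close>
  satisfy \<open>v \<le> u c / s^2\<close> and \<open>u \<le> v c / t^2\<close>. Multiplying forces
  equality in Cauchy-Schwarz, that is, perfect correlation. What remains is either a repeated row,
  which is excluded, or a null event.\<close>

lemma AE_wedge_disjoint:
  assumes i: "C $ i $ i > 0" and j: "C $ j $ j > 0" and ij: "C $ i \<noteq> C $ j" and z: "z > 0"
  shows "AE \<omega> in P. \<not> (\<omega> \<in> wedge i z \<and> \<omega> \<in> wedge j z)"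
proof -
  define s t c where "s = sqrt (C $ i $ i)" and "t = sqrt (C $ j $ j)" and "c = C $ i $ j"
  have s: "s > 0" "C $ i $ i = s\<^sup>2" and t: "t > 0" "C $ j $ j = t\<^sup>2"
    using i j by (auto simp: s_def t_def)
  have c: "C $ j $ i = c" by (simp add: c_def cov_sym)
  have CS: "c\<^sup>2 \<le> s\<^sup>2 * t\<^sup>2"
    using cov_Cauchy_Schwarz[of "axis i 1" "axis j 1"] by (simp add: cov_axis c_def s t)
  have *: "c = s * t \<and> s * (Z \<omega> $ j - z) = t * (Z \<omega> $ i - z)"
    if \<omega>: "\<omega> \<in> wedge i z" "\<omega> \<in> wedge j z" for \<omega>
  proof -
    define u v where "u = Z \<omega> $ i - z" and "v = Z \<omega> $ j - z"
    have u: "u > 0" and v: "v > 0" using \<omega> by (auto simp: wedge_def u_def v_def)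
    have "resid i \<omega> $ j \<le> z * (1 - slope i $ j)" "resid j \<omega> $ i \<le> z * (1 - slope j $ i)"
      using \<omega> by (auto simp: wedge_def facet_def)
    then have "v \<le> u * (c / s\<^sup>2)" "u \<le> v * (c / t\<^sup>2)"
      unfolding resid_coord slope_coord s(2) t(2) c c_def[symmetric] u_def v_def
      by (simp_all only: algebra_simps)
    then have vu: "s\<^sup>2 * v \<le> c * u" "t\<^sup>2 * u \<le> c * v"
      using s t by (simp_all add: field_simps)
    \<comment> \<open>Positivity of \<open>c\<close> allows the two inequalities to be multiplied
      and later selects \<open>c = s * t\<close> over \<open>- s * t\<close>.\<close>
    have "0 < s\<^sup>2 * v" using s v by simp
    with vu(1) have "0 < c * u" by linarith
    then have c0: "c > 0" using u by (simp add: zero_less_mult_iff)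
    have "(s\<^sup>2 * v) * (t\<^sup>2 * u) \<le> (c * u) * (c * v)"
      using s t u v c0 by (intro mult_mono[OF vu]) auto
    then have "(s\<^sup>2 * t\<^sup>2) * (u * v) \<le> c\<^sup>2 * (u * v)"
      by (simp add: power2_eq_square algebra_simps)
    then have "s\<^sup>2 * t\<^sup>2 \<le> c\<^sup>2" using u v by (simp add: mult_le_cancel_right)
    with CS have "c\<^sup>2 = (s * t)\<^sup>2" by (simp add: power_mult_distrib)
    then have cst: "c = s * t" using c0 s t by (simp add: power2_eq_iff_nonneg)
    have "s * v \<le> t * u" using vu(1) s unfolding cst by (simp add: power2_eq_square)
    moreover have "t * u \<le> s * v" using vu(2) t unfolding cst by (simp add: power2_eq_square)
    ultimately show ?thesis using cst by (simp add: u_def v_def)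
  qed
  show ?thesis
  proof (cases "s = t")
    case True
    have "\<not> (\<omega> \<in> wedge i z \<and> \<omega> \<in> wedge j z)" for \<omega>
    proof
      assume "\<omega> \<in> wedge i z \<and> \<omega> \<in> wedge j z"
      with * have "c = s * t" by blast
      then have "C $ i = C $ j"
        using True by (intro cov_row_eqI) (auto simp: s t c_def[symmetric] power2_eq_square)
      with ij show False by simp
    qed
    then show ?thesis by simp
  next
    case False
    \<comment> \<open>Lying in both wedges makes \<open>s Z\<^sub>j - t Z\<^sub>i\<close> equal to
      the fixed number \<open>(s - t) z\<close>, which is nonzero and therefore hit with probability
      zero.\<close>
    then have "s * z - t * z \<noteq> 0" using z by (simp flip: left_diff_distrib)
    then have "AE \<omega> in P. (s *\<^sub>R axis j 1 - t *\<^sub>R axis i 1) \<bullet> Z \<omega> \<noteq> s * z - t * z"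
      by (rule AE_inner_neq)
    then show ?thesis
    proof eventually_elim
      case (elim \<omega>)
      then have "s * (Z \<omega> $ j - z) \<noteq> t * (Z \<omega> $ i - z)"
        by (simp add: inner_diff_left inner_axis' algebra_simps)
      with * show ?case by blast
    qed
  qed
qed

text \<open>Almost sure disjointness bounds the sum of the indicators by 1. Injectivity keeps one
  index per distinct row, since equal rows produce almost surely the same wedge.\<close>

lemma sum_prob_wedge_le_1:
  assumes inj: "inj_on (($) C) I" and I: "\<And>i. i \<in> I \<Longrightarrow> C $ i $ i > 0" and z: "z > 0"
  shows "(\<Sum>i\<in>I. prob (wedge i z)) \<le> 1"
proof -
  have disj: "AE \<omega> in P. \<forall>i\<in>I. \<forall>j\<in>I. i \<noteq> j \<longrightarrow> \<not> (\<omega> \<in> wedge i z \<and> \<omega> \<in> wedge j z)"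
  proof (intro AE_finite_allI)
    fix i j assume "i \<in> I" "j \<in> I"
    show "AE \<omega> in P. i \<noteq> j \<longrightarrow> \<not> (\<omega> \<in> wedge i z \<and> \<omega> \<in> wedge j z)"
    proof (cases "i = j")
      case False
      then have "C $ i \<noteq> C $ j" using inj \<open>i \<in> I\<close> \<open>j \<in> I\<close> by (auto simp: inj_on_def)
      then show ?thesis using AE_wedge_disjoint[of i j z] I \<open>i \<in> I\<close> \<open>j \<in> I\<close> z by auto
    qed simp
  qed auto
  have "(\<Sum>i\<in>I. prob (wedge i z)) = (\<integral>\<omega>. (\<Sum>i\<in>I. indicat_real (wedge i z) \<omega>) \<partial>P)"
    by (subst Bochner_Integration.integral_sum) (auto simp: emeasure_eq_measure)
  also have "\<dots> \<le> (\<integral>\<omega>. 1 \<partial>P)"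
  proof (rule integral_mono_AE)
    show "AE \<omega> in P. (\<Sum>i\<in>I. indicat_real (wedge i z) \<omega>) \<le> 1"
      using disj
    proof eventually_elim
      case (elim \<omega>)
      show ?case
      proof (cases "\<exists>i\<in>I. \<omega> \<in> wedge i z")
        case True
        then obtain i where i: "i \<in> I" "\<omega> \<in> wedge i z" by blast
        have "(\<Sum>i\<in>I. indicat_real (wedge i z) \<omega>) = (\<Sum>j\<in>I. if j = i then 1 else 0)"
          using elim i by (intro sum.cong) (auto split: split_indicator)
        then show ?thesis using i by simp
      next
        case False
        then have "(\<Sum>i\<in>I. indicat_real (wedge i z) \<omega>) = 0" by (intro sum.neutral) auto
        then show ?thesis by simp
      qed
    qed
  qed (auto simp: emeasure_eq_measure)
  finally show ?thesis by (simp add: prob_space)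
qed

text \<open>When \<open>I\<close> represents all distinct rows of positive variance, the left side
  is the density of \<open>log M\<close> at \<open>log z\<close>. Coordinates with
  \<open>z \<le> R \<sigma>\<close> are charged to their wedges by Mills' ratio, the others to the
  far bound.\<close>

lemma sum_facet_density_le:
  assumes inj: "inj_on (($) C) I" and I: "\<And>i. i \<in> I \<Longrightarrow> C $ i $ i > 0" and z: "z > 0"
    and p: "ln (real CARD('n)) \<ge> 1 / 2"
  shows "(\<Sum>i\<in>I. z * normal_density 0 (sqrt (C $ i $ i)) z * prob (facet i z))
    \<le> 2 * ln (real CARD('n)) + 1 + sqrt (ln (real CARD('n)) / pi)"
proof -
  define l where "l = ln (real CARD('n))"
  \<comment> \<open>This cutoff makes \<open>exp (- R^2 / 2)\<close> equal to \<open>1 / p\<close>,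
    so that at most \<open>p\<close> far terms add up to \<open>sqrt (l / pi)\<close>;
    \<open>l \<ge> 1/2\<close> gives the \<open>R \<ge> 1\<close> that the far bound
    requires.\<close>
  define R where "R = sqrt (2 * l)"
  have l: "l \<ge> 1 / 2" using p by (simp add: l_def)
  have R: "R \<ge> 1" "R\<^sup>2 = 2 * l" using l by (auto simp: R_def)
  have expl: "exp (- R\<^sup>2 / 2) = 1 / real CARD('n)"
    unfolding R by (simp add: l_def exp_minus inverse_eq_divide)
  have far: "R * exp (- R\<^sup>2 / 2) / sqrt (2 * pi) = sqrt (l / pi) / real CARD('n)"
    unfolding expl unfolding R_def by (simp add: real_sqrt_mult real_sqrt_divide)
  have "z * normal_density 0 (sqrt (C $ i $ i)) z * prob (facet i z)
      \<le> (2 * l + 1) * prob (wedge i z) + sqrt (l / pi) / real CARD('n)" if "i \<in> I" for i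
  proof -
    define \<sigma> where "\<sigma> = sqrt (C $ i $ i)"
    have \<sigma>: "\<sigma> > 0" using I[OF that] by (simp add: \<sigma>_def)
    have [simp]: "0 \<le> sqrt (l / pi) / real CARD('n)" using l by simp
    show ?thesis
    proof (cases "z / \<sigma> \<le> R")
      case True
      let ?T = "measure (density lborel (\<lambda>x. ennreal (normal_density 0 \<sigma> x))) {z<..}"
      have "z\<^sup>2 / \<sigma>\<^sup>2 \<le> 2 * l"
        using power_mono[OF True, of 2] z \<sigma> R by (simp add: power_divide)
      then have "(z\<^sup>2 / \<sigma>\<^sup>2 + 1) * ?T \<le> (2 * l + 1) * ?T"
        by (intro mult_right_mono) auto
      then have "z * normal_density 0 \<sigma> z \<le> (2 * l + 1) * ?T"
        using normal_density_tail_bound[OF \<sigma> z] by linarith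
      then have "z * normal_density 0 \<sigma> z * prob (facet i z) \<le> (2 * l + 1) * ?T * prob (facet i z)"
        by (intro mult_right_mono) auto
      also have "\<dots> = (2 * l + 1) * prob (wedge i z)"
        by (simp add: prob_wedge[OF I[OF that]] \<sigma>_def)
      finally show ?thesis unfolding \<sigma>_def
        using \<open>0 \<le> sqrt (l / pi) / real CARD('n)\<close> by linarith
    next
      case False
      have "z * normal_density 0 \<sigma> z * prob (facet i z) \<le> z * normal_density 0 \<sigma> z"
        using z by (intro mult_left_le) auto
      also have "\<dots> \<le> sqrt (l / pi) / real CARD('n)"
        using normal_density_far_bound[OF \<sigma> R(1)] False unfolding far by simp
      moreover have "0 \<le> (2 * l + 1) * prob (wedge i z)" using l by simp
      ultimately show ?thesis unfolding \<sigma>_def by linarith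
    qed
  qed
  then have "(\<Sum>i\<in>I. z * normal_density 0 (sqrt (C $ i $ i)) z * prob (facet i z))
      \<le> (\<Sum>i\<in>I. (2 * l + 1) * prob (wedge i z) + sqrt (l / pi) / real CARD('n))"
    by (rule sum_mono)
  also have "\<dots> = (2 * l + 1) * (\<Sum>i\<in>I. prob (wedge i z)) + real (card I) / real CARD('n) * sqrt (l / pi)"
    by (simp add: sum.distrib sum_distrib_left)
  also have "\<dots> \<le> (2 * l + 1) * 1 + 1 * sqrt (l / pi)"
    using l sum_prob_wedge_le_1[OF inj I z] card_mono[of UNIV I]
    by (intro add_mono mult_left_mono mult_right_mono) auto
  finally show ?thesis by (simp add: l_def)
qed

section \<open>The law of the maximum on the positive axis\<close>

lemma max_coord_measurable [measurable]: "(\<lambda>\<omega>. max_coord (Z \<omega>)) \<in> borel_measurable P"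
proof -
  have "(\<lambda>\<omega>. max_coord (Z \<omega>)) = (\<lambda>\<omega>. Max ((\<lambda>i. Z \<omega> $ i) ` UNIV))"
    by (simp add: max_coord_def)
  also have "\<dots> \<in> borel_measurable P" by (rule borel_measurable_Max) auto
  finally show ?thesis .
qed

text \<open>A maximiser may be replaced by the chosen index with the same row, since these
  coordinates agree almost surely. A coordinate of variance zero vanishes almost surely and cannot
  realise a positive maximum.\<close>

lemma AE_max_coord_attained:
  assumes J: "($) C ` J = range (($) C)"
  shows "AE \<omega> in P. 0 < max_coord (Z \<omega>) \<longrightarrow>
    (\<exists>i\<in>{i \<in> J. 0 < C $ i $ i}. Z \<omega> $ i = max_coord (Z \<omega>) \<and> (\<forall>j. Z \<omega> $ j \<le> Z \<omega> $ i))"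
proof -
  have "\<forall>k. \<exists>j. j \<in> J \<and> C $ k = C $ j" using J by blast
  then obtain r where r: "\<And>k. r k \<in> J" "\<And>k. C $ k = C $ r k" by metis
  have "AE \<omega> in P. \<forall>k. Z \<omega> $ k = Z \<omega> $ r k"
    using AE_coord_eq[OF r(2)] by (simp add: AE_all_countable)
  moreover have "AE \<omega> in P. \<forall>k. C $ k $ k = 0 \<longrightarrow> Z \<omega> $ k = 0"
  proof -
    have "AE \<omega> in P. C $ k $ k = 0 \<longrightarrow> Z \<omega> $ k = 0" for k
      using AE_inner_eq_0[of "axis k 1", unfolded cov_axis] by (cases "C $ k $ k = 0") (auto simp: inner_axis')
    then show ?thesis by (simp add: AE_all_countable)
  qed
  ultimately show ?thesis
  proof eventually_elim
    case (elim \<omega>)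
    show ?case
    proof
      assume pos: "0 < max_coord (Z \<omega>)"
      have "max_coord (Z \<omega>) \<in> range (\<lambda>i. Z \<omega> $ i)"
        unfolding max_coord_def by (rule Max_in) auto
      then obtain k where k: "max_coord (Z \<omega>) = Z \<omega> $ k" by blast
      have le: "Z \<omega> $ j \<le> max_coord (Z \<omega>)" for j
        unfolding max_coord_def by (rule Max_ge) auto
      have Zr: "Z \<omega> $ r k = max_coord (Z \<omega>)" using elim(1) k by metis
      then have "C $ r k $ r k \<noteq> 0" using elim(2) pos by fastforce
      then have "r k \<in> {i \<in> J. 0 < C $ i $ i}"
        using r(1)[of k] cov_diag_nonneg[of "r k"] by auto
      with Zr le show "\<exists>i\<in>{i \<in> J. 0 < C $ i $ i}. Z \<omega> $ i = max_coord (Z \<omega>) \<and> (\<forall>j. Z \<omega> $ j \<le> Z \<omega> $ i)"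
        by (intro bexI[of _ "r k"]) auto
    qed
  qed
qed

text \<open>Splitting by the representative that attains the maximum gives an integral of facet
  densities; their sum is at most \<open>L / x\<close>, with antiderivative
  \<open>L * ln x\<close>.\<close>

lemma prob_max_coord_interval_le:
  assumes p: "ln (real CARD('n)) \<ge> 1 / 2" and a: "0 < a" and ab: "a \<le> b"
  shows "\<P>(\<omega> in P. a < max_coord (Z \<omega>) \<and> max_coord (Z \<omega>) \<le> b)
    \<le> (2 * ln (real CARD('n)) + 1 + sqrt (ln (real CARD('n)) / pi)) * (ln b - ln a)"
proof -
  define L where "L = 2 * ln (real CARD('n)) + 1 + sqrt (ln (real CARD('n)) / pi)"
  have L: "L \<ge> 0" using p by (auto simp: L_def)
  \<comment> \<open>\<open>J\<close> holds one index for each distinct row of \<open>C\<close>;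
    \<open>I\<close> then discards variance zero.\<close>
  obtain J where inj: "inj_on (($) C) J" and J: "range (($) C) = ($) C ` J"
    using subset_image_inj[of "range (($) C)" "($) C" UNIV] by auto
  define I where "I = {i \<in> J. 0 < C $ i $ i}"
  have I: "inj_on (($) C) I" "\<And>i. i \<in> I \<Longrightarrow> C $ i $ i > 0"
    using inj by (auto simp: I_def inj_on_def)
  define E where "E i = {\<omega> \<in> space P. (a < Z \<omega> $ i \<and> Z \<omega> $ i \<le> b) \<and> (\<forall>j. Z \<omega> $ j \<le> Z \<omega> $ i)}" for i
  have E_sets [measurable]: "E i \<in> events" for i unfolding E_def by measurable
  \<comment> \<open>Given \<open>Z\<^sub>i = x\<close>, all other coordinates are at most
    \<open>x\<close> exactly when the residual satisfies the facet condition at level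
    \<open>x\<close>.\<close>
  have E_eq: "emeasure P (E i) = (\<integral>\<^sup>+x. ennreal (normal_density 0 (sqrt (C $ i $ i)) x) *
       (indicator {a<..b} x * emeasure P (facet i x)) \<partial>lborel)" if "i \<in> I" for i
  proof -
    let ?A = "({a<..b} \<times> UNIV) \<inter> {xw :: real \<times> (real ^ 'n). \<forall>j. snd xw $ j \<le> fst xw * (1 - slope i $ j)}"
    have A: "?A \<in> sets (borel \<Otimes>\<^sub>M borel)" by measurable
    have "E i = {\<omega> \<in> space P. (Z \<omega> $ i, resid i \<omega>) \<in> ?A}"
      by (auto simp: E_def resid_coord algebra_simps)
    moreover have "emeasure P {\<omega> \<in> space P. (x, resid i \<omega>) \<in> ?A}
        = indicator {a<..b} x * emeasure P (facet i x)" for x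
      by (auto simp: facet_def split: split_indicator)
    ultimately show ?thesis using emeasure_coord_resid[OF I(2)[OF that] A] by simp
  qed
  have "emeasure P {\<omega> \<in> space P. a < max_coord (Z \<omega>) \<and> max_coord (Z \<omega>) \<le> b}
      \<le> emeasure P (\<Union>i\<in>I. E i)"
  proof (rule emeasure_mono_AE)
    show "AE \<omega> in P. \<omega> \<in> {\<omega> \<in> space P. a < max_coord (Z \<omega>) \<and> max_coord (Z \<omega>) \<le> b}
        \<longrightarrow> \<omega> \<in> (\<Union>i\<in>I. E i)"
      using AE_max_coord_attained[OF J[symmetric]]
      by eventually_elim (use a in \<open>fastforce simp: E_def I_def\<close>)
  qed measurable
  also have "\<dots> \<le> (\<Sum>i\<in>I. emeasure P (E i))"
    by (rule emeasure_subadditive_finite) auto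
  also have "\<dots> = (\<integral>\<^sup>+x. (\<Sum>i\<in>I. ennreal (normal_density 0 (sqrt (C $ i $ i)) x) *
       (indicator {a<..b} x * emeasure P (facet i x))) \<partial>lborel)"
    by (simp add: E_eq) (subst nn_integral_sum, auto)
  also have "\<dots> \<le> (\<integral>\<^sup>+x. ennreal (L / x) * indicator {a..b} x \<partial>lborel)"
  proof (rule nn_integral_mono)
    fix x
    show "(\<Sum>i\<in>I. ennreal (normal_density 0 (sqrt (C $ i $ i)) x) *
       (indicator {a<..b} x * emeasure P (facet i x))) \<le> ennreal (L / x) * indicator {a..b} x"
    proof (cases "x \<in> {a<..b}")
      case True
      then have x: "x > 0" using a by simp
      have "x * (\<Sum>i\<in>I. normal_density 0 (sqrt (C $ i $ i)) x * prob (facet i x)) \<le> L"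
        using sum_facet_density_le[OF I x p] by (simp add: L_def sum_distrib_left mult.assoc)
      then have "(\<Sum>i\<in>I. normal_density 0 (sqrt (C $ i $ i)) x * prob (facet i x)) \<le> L / x"
        using x by (simp add: field_simps)
      then show ?thesis using True
        by (simp add: emeasure_eq_measure ennreal_mult'[symmetric] sum_ennreal ennreal_leI)
    qed auto
  qed
  also have "\<dots> = ennreal (L * ln b - L * ln a)"
  proof (rule nn_integral_FTC_Icc)
    show "((\<lambda>x. L * ln x) has_real_derivative L / x) (at x)" if "x \<in> {a..b}" for x
      using that a by (auto intro!: derivative_eq_intros)
  qed (use a ab L in auto)
  finally have "ennreal (\<P>(\<omega> in P. a < max_coord (Z \<omega>) \<and> max_coord (Z \<omega>) \<le> b)) \<le> ennreal (L * ln b - L * ln a)"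
    by (simp add: emeasure_eq_measure)
  moreover have "0 \<le> L * ln b - L * ln a"
    using L a ab by (auto intro!: mult_left_mono)
  ultimately have "\<P>(\<omega> in P. a < max_coord (Z \<omega>) \<and> max_coord (Z \<omega>) \<le> b) \<le> L * ln b - L * ln a"
    by simp
  then show ?thesis by (simp add: L_def right_diff_distrib)
qed

end

subsection \<open>The lower bound on the variance\<close>

text \<open>The left side has derivative \<open>2 / (1 - x^2)\<close>, at most
  \<open>2 / 0.9856 < 2.03\<close> up to 0.12. The value 0.12 is \<open>4 * 0.03\<close>, the
  largest relative radius used below.\<close>

lemma ln_add_diff_le:
  fixes x :: real
  assumes "0 \<le> x" "x \<le> 0.12"
  shows "ln (1 + x) - ln (1 - x) \<le> 2.03 * x"
proof -
  let ?f = "\<lambda>x::real. 2.03 * x - (ln (1 + x) - ln (1 - x))"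
  have "?f 0 \<le> ?f x"
  proof (rule DERIV_nonneg_imp_nondecreasing[OF assms(1)])
    fix t :: real
    assume t: "0 \<le> t" "t \<le> x"
    then have t': "t \<le> 0.12" using assms by simp
    have "(?f has_real_derivative 2.03 - (1 / (1 + t) - (- 1) / (1 - t))) (at t)"
      using t t' by (auto intro!: derivative_eq_intros)
    moreover have "0 \<le> 2.03 - (1 / (1 + t) - (- 1) / (1 - t))"
    proof -
      have "t * t \<le> 0.12 * 0.12" using t t' by (intro mult_mono) auto
      then have "2 \<le> 2.03 * ((1 + t) * (1 - t))" by (simp add: algebra_simps)
      moreover have "1 / (1 + t) - (- 1) / (1 - t) = 2 / ((1 + t) * (1 - t))"
        using t t' by (simp add: field_simps)
      ultimately show ?thesis using t t' by (simp add: pos_divide_le_eq)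
    qed
    ultimately show "\<exists>y. (?f has_real_derivative y) (at t) \<and> 0 \<le> y" by blast
  qed
  then show ?thesis by simp
qed

text \<open>
  Four thresholds instead of the single one of Chebyshev's inequality: the constant that a single
  threshold yields is too weak for the case of three coordinates.
\<close>
lemma (in prob_space) variance_ge_of_small_ball:
  fixes X :: "'a \<Rightarrow> real" and m K d :: real
  assumes [measurable]: "X \<in> borel_measurable M" and int: "integrable M (\<lambda>\<omega>. (X \<omega> - m)\<^sup>2)"
    and d: "0 \<le> d"
    and ball: "\<And>k. k \<in> {1, 2, 3, 4} \<Longrightarrow> \<P>(\<omega> in M. \<bar>X \<omega> - m\<bar> < k * d) \<le> K * k"
  shows "d\<^sup>2 * (16 - 50 * K) \<le> expectation (\<lambda>\<omega>. (X \<omega> - m)\<^sup>2)"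
proof -
  define T where "T k = {\<omega> \<in> space M. \<not> \<bar>X \<omega> - m\<bar> < k * d}" for k :: real
  have [measurable]: "T k \<in> events" for k unfolding T_def by measurable
  have iT: "integrable M (indicat_real (T k))" for k
    by (intro integrable_real_indicator) (auto simp: emeasure_eq_measure)
  have T: "1 - K * k \<le> prob (T k)" if "k \<in> {1, 2, 3, 4}" for k
  proof -
    have "prob (T k) = 1 - \<P>(\<omega> in M. \<bar>X \<omega> - m\<bar> < k * d)"
      unfolding T_def by (rule prob_neg) measurable
    then show ?thesis using ball[OF that] by simp
  qed
  \<comment> \<open>The weights 1, 3, 5, 7 are differences of consecutive squares: passing exactly
    the first \<open>k\<close> thresholds contributes \<open>k^2 d^2\<close>, at most the squared
    deviation. They sum to 16, and to 50 when multiplied by the thresholds 1 to 4.\<close>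
  have "d\<^sup>2 * (16 - 50 * K) = d\<^sup>2 * ((1 - K * 1) + 3 * (1 - K * 2) + 5 * (1 - K * 3) + 7 * (1 - K * 4))"
    by (simp add: algebra_simps)
  also have "\<dots> \<le> d\<^sup>2 * (prob (T 1) + 3 * prob (T 2) + 5 * prob (T 3) + 7 * prob (T 4))"
  proof (rule mult_left_mono)
    have "1 - K * 1 \<le> prob (T 1)" "1 - K * 2 \<le> prob (T 2)" "1 - K * 3 \<le> prob (T 3)" "1 - K * 4 \<le> prob (T 4)"
      by (rule T, simp)+
    then show "(1 - K * 1) + 3 * (1 - K * 2) + 5 * (1 - K * 3) + 7 * (1 - K * 4)
      \<le> prob (T 1) + 3 * prob (T 2) + 5 * prob (T 3) + 7 * prob (T 4)"
      by (intro add_mono mult_left_mono) auto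
  qed simp
  also have "\<dots> = expectation (\<lambda>\<omega>. d\<^sup>2 * (indicator (T 1) \<omega> + 3 * indicator (T 2) \<omega>
      + 5 * indicator (T 3) \<omega> + 7 * indicator (T 4) \<omega>))"
    by (simp add: iT)
  also have "\<dots> \<le> expectation (\<lambda>\<omega>. (X \<omega> - m)\<^sup>2)"
  proof (rule integral_mono[OF _ int])
    fix \<omega> assume \<omega>: "\<omega> \<in> space M"
    define r where "r = \<bar>X \<omega> - m\<bar>"
    have T_iff: "\<omega> \<in> T k \<longleftrightarrow> k * d \<le> r" for k using \<omega> by (auto simp: T_def r_def)
    have sq: "k\<^sup>2 * d\<^sup>2 \<le> (X \<omega> - m)\<^sup>2" if "\<omega> \<in> T k" "0 \<le> k" for k
      using power_mono[of "k * d" r 2] d that by (simp add: T_iff power_mult_distrib r_def)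
    have mono: "\<omega> \<in> T j" if "\<omega> \<in> T k" "j \<le> k" for j k
      using that mult_right_mono[of j k d] d by (simp add: T_iff)
    consider "\<omega> \<notin> T 1" "\<omega> \<notin> T 2" "\<omega> \<notin> T 3" "\<omega> \<notin> T 4"
      | "\<omega> \<in> T 1" "\<omega> \<notin> T 2" "\<omega> \<notin> T 3" "\<omega> \<notin> T 4"
      | "\<omega> \<in> T 1" "\<omega> \<in> T 2" "\<omega> \<notin> T 3" "\<omega> \<notin> T 4"
      | "\<omega> \<in> T 1" "\<omega> \<in> T 2" "\<omega> \<in> T 3" "\<omega> \<notin> T 4"
      | "\<omega> \<in> T 1" "\<omega> \<in> T 2" "\<omega> \<in> T 3" "\<omega> \<in> T 4"
    proof -
      have "\<omega> \<in> T 4 \<longrightarrow> \<omega> \<in> T 3" "\<omega> \<in> T 3 \<longrightarrow> \<omega> \<in> T 2" "\<omega> \<in> T 2 \<longrightarrow> \<omega> \<in> T 1"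
        using mono[of 4 3] mono[of 3 2] mono[of 2 1] by simp_all
      then show ?thesis using that by blast
    qed
    then show "d\<^sup>2 * (indicator (T 1) \<omega> + 3 * indicator (T 2) \<omega>
      + 5 * indicator (T 3) \<omega> + 7 * indicator (T 4) \<omega>) \<le> (X \<omega> - m)\<^sup>2"
      using sq[of 1] sq[of 2] sq[of 3] sq[of 4] by cases simp_all
  qed (simp add: iT)
  finally show ?thesis .
qed

section \<open>Square integrability and the choice of constants\<close>

context gaussian_vector
begin

lemma integrable_coord_square: "integrable P (\<lambda>\<omega>. (Z \<omega> $ i)\<^sup>2)"
proof (cases "C $ i $ i = 0")
  case True
  then have "AE \<omega> in P. (Z \<omega> $ i)\<^sup>2 = 0"
    using AE_inner_eq_0[of "axis i 1", unfolded cov_axis] by (auto simp: inner_axis')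
  then show ?thesis by (subst integrable_cong_AE[where g="\<lambda>_. 0"]) auto
next
  case False
  then have i: "C $ i $ i > 0" using cov_diag_nonneg[of i] by simp
  have "integrable (distr P borel (\<lambda>\<omega>. Z \<omega> $ i)) (\<lambda>x. x\<^sup>2)"
    unfolding distr_coord[OF i] using i integrable_normal_moment[of "sqrt (C $ i $ i)" 0 2]
    by (subst integrable_density) auto
  then show ?thesis by (subst (asm) integrable_distr_eq) auto
qed

lemma integrable_max_coord_square: "integrable P (\<lambda>\<omega>. (max_coord (Z \<omega>))\<^sup>2)"
proof (rule Bochner_Integration.integrable_bound)
  show "integrable P (\<lambda>\<omega>. \<Sum>i\<in>UNIV. (Z \<omega> $ i)\<^sup>2)"
    by (intro Bochner_Integration.integrable_sum integrable_coord_square)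
  show "AE \<omega> in P. norm ((max_coord (Z \<omega>))\<^sup>2) \<le> norm (\<Sum>i\<in>UNIV. (Z \<omega> $ i)\<^sup>2)"
  proof (rule AE_I2)
    fix \<omega>
    have "max_coord (Z \<omega>) \<in> range (\<lambda>i. Z \<omega> $ i)"
      unfolding max_coord_def by (rule Max_in) auto
    then obtain k where k: "max_coord (Z \<omega>) = Z \<omega> $ k" by blast
    have "(Z \<omega> $ k)\<^sup>2 \<le> (\<Sum>i\<in>UNIV. (Z \<omega> $ i)\<^sup>2)"
      by (rule member_le_sum) auto
    then show "norm ((max_coord (Z \<omega>))\<^sup>2) \<le> norm (\<Sum>i\<in>UNIV. (Z \<omega> $ i)\<^sup>2)"
      by (simp add: k sum_nonneg)
  qed
qed measurable

lemma variance_max_coord_ge: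
  assumes p: "CARD('n) \<ge> 3" and pos: "expectation (\<lambda>\<omega>. max_coord (Z \<omega>)) > 0"
  shows "expectation (\<lambda>\<omega>. max_coord (Z \<omega>)) / (15 * ln (real CARD('n)))
    \<le> sqrt (variance (\<lambda>\<omega>. max_coord (Z \<omega>)))"
proof -
  define l where "l = ln (real CARD('n))"
  define \<mu> where "\<mu> = expectation (\<lambda>\<omega>. max_coord (Z \<omega>))"
  \<comment> \<open>Scaling by \<open>1 / l\<close> cancels the logarithm in the small-ball bound.
    The factor 0.03 nearly maximises \<open>c^2 (16 - 50 * 3.58 * 2.03 * c)\<close>.\<close>
  define y where "y = 0.03 / l"
  have "exp 1 \<le> real CARD('n)" using exp_le p by linarith
  then have l: "l \<ge> 1" unfolding l_def using p by (subst ln_ge_iff) auto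
  have \<mu>: "\<mu> > 0" using pos by (simp add: \<mu>_def)
  have y: "0 < y" "y \<le> 0.03" using l by (auto simp: y_def field_simps)
  \<comment> \<open>\<open>3.58 = 2 + 1 + 0.58\<close>: \<open>l \<ge> 1\<close> absorbs the
    constant 1, and \<open>1 / pi < 1 / 3 < 0.58^2\<close> handles the root.\<close>
  have L: "2 * l + 1 + sqrt (l / pi) \<le> 3.58 * l"
  proof -
    have "l / pi \<le> l / 3" using l pi_gt3 by (intro divide_left_mono) auto
    also have "\<dots> \<le> (0.58 * l)\<^sup>2" using l by (simp add: power2_eq_square)
    finally have "sqrt (l / pi) \<le> 0.58 * l" using l by (intro real_le_lsqrt) auto
    then show ?thesis using l by simp
  qed
  \<comment> \<open>The factors come from the density bound, the logarithmic length of the interval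
    and \<open>y * l\<close>.\<close>
  have ball: "\<P>(\<omega> in P. \<bar>max_coord (Z \<omega>) - \<mu>\<bar> < k * (y * \<mu>)) \<le> 3.58 * 2.03 * 0.03 * k"
    if "k \<in> {1, 2, 3, 4}" for k
  proof -
    define x where "x = k * y"
    have k: "0 < k" "k \<le> 4" using that by auto
    have "x \<le> 4 * 0.03" unfolding x_def using k y by (intro mult_mono) auto
    then have x: "0 < x" "x \<le> 0.12" using k y by (auto simp: x_def)
    have "\<P>(\<omega> in P. \<bar>max_coord (Z \<omega>) - \<mu>\<bar> < k * (y * \<mu>))
        \<le> \<P>(\<omega> in P. \<mu> * (1 - x) < max_coord (Z \<omega>) \<and> max_coord (Z \<omega>) \<le> \<mu> * (1 + x))"
      by (intro finite_measure_mono) (auto simp: x_def abs_if algebra_simps split: if_splits)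
    also have "\<dots> \<le> (2 * l + 1 + sqrt (l / pi)) * (ln (\<mu> * (1 + x)) - ln (\<mu> * (1 - x)))"
      using prob_max_coord_interval_le[of "\<mu> * (1 - x)" "\<mu> * (1 + x)"] l x \<mu>
      by (auto simp: l_def)
    also have "ln (\<mu> * (1 + x)) - ln (\<mu> * (1 - x)) = ln (1 + x) - ln (1 - x)"
      using \<mu> x by (simp add: ln_mult)
    also have "(2 * l + 1 + sqrt (l / pi)) * (ln (1 + x) - ln (1 - x)) \<le> (3.58 * l) * (2.03 * x)"
      using ln_add_diff_le[of x] x l by (intro mult_mono L) auto
    also have "\<dots> = 3.58 * 2.03 * 0.03 * k"
      using l by (simp add: x_def y_def)
    finally show ?thesis .
  qed
  have sq: "integrable P (\<lambda>\<omega>. (max_coord (Z \<omega>) - \<mu>)\<^sup>2)"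
    using integrable_max_coord_square square_integrable_imp_integrable[OF _ integrable_max_coord_square]
    by (auto simp: power2_diff)
  have "(y * \<mu>)\<^sup>2 * (16 - 50 * (3.58 * 2.03 * 0.03)) \<le> variance (\<lambda>\<omega>. max_coord (Z \<omega>))"
    unfolding \<mu>_def[symmetric]
    by (rule variance_ge_of_small_ball[OF _ sq _ ball]) (use y \<mu> in auto)
  \<comment> \<open>Numerically, \<open>0.03^2 * (16 - 50 * K)\<close> is about 0.00459, just above
    \<open>1 / 225\<close>, about 0.00444.\<close>
  moreover have "(\<mu> / (15 * l))\<^sup>2 \<le> (y * \<mu>)\<^sup>2 * (16 - 50 * (3.58 * 2.03 * 0.03))"
  proof -
    define q where "q = \<mu> / l"
    have q: "\<mu> / (15 * l) = q / 15" "y * \<mu> = q * 0.03" by (simp_all add: q_def y_def)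
    show ?thesis unfolding q by (simp add: power_divide power_mult_distrib)
  qed
  ultimately have "\<mu> / (15 * l) \<le> sqrt (variance (\<lambda>\<omega>. max_coord (Z \<omega>)))"
    by (intro real_le_rsqrt) linarith
  then show ?thesis by (simp add: \<mu>_def l_def)
qed

end

theorem proposition6:
  fixes P :: "'a measure" and Z :: "'a \<Rightarrow> real ^ 'n" and C :: "real ^ 'n ^ 'n"
  assumes "CARD('n) \<ge> 3"
    and "centered_gaussian_vector P Z C"
    and "prob_space.expectation P (\<lambda>\<omega>. max_coord (Z \<omega>)) > 0"
  shows "sqrt (prob_space.variance P (\<lambda>\<omega>. max_coord (Z \<omega>)))
         \<ge> prob_space.expectation P (\<lambda>\<omega>. max_coord (Z \<omega>)) / (15 * ln (real CARD('n)))"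
proof -
  interpret gaussian_vector P Z C by unfold_locales (fact assms)
  show ?thesis using assms(1,3) by (rule variance_max_coord_ge)
qed

end
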